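(* Let $K$ be either $\mathbb{R}^n_+$ or $\mathbb{S}^n_+$, let $L$ be an affine subspace of the ambient space ($\mathbb{R}^n$ or $\mathbb{S}^n$, respectively) with $L\cap K\neq\emptyset$, let $F\unlhd K$ be a face, and let $w\in L^\perp\cap(F^*\setminus F^\perp)$ be an exposing vector for $L\cap F$. 1. If $K=\mathbb{R}^n_+$ and $\dim(F)-\dim(F\cap w^\perp)=1$, then $w$ is minimal for $L\cap F$. 2. If $K=\mathbb{S}^n_+$ and $\max\{\operatorname{rank}(X)\mid X\in F\}-\max\{\operatorname{rank}(X)\mid X\in F\cap w^\perp\}=1$, then $w$ is minimal for $L\cap F$.
   Context: $\mathbb{R}^n_+$ is the nonnegative orthant; $\mathbb{S}^n$ is the space of real symmetric $n\times n$ matrices with trace inner product $\langle X,Y\rangle=\mathrm{tr}(XY)$, and $\mathbb{S}^n_+$ the cone of positive semidefinite matrices. For a cone $F$, $F^*=\{y\mid\langle y,x\rangle\ge 0\ \forall x\in F\}$ in the ambient space. For a set $S$, $S^\perp=\{y\mid \langle y,x\rangle=0\ \forall x\in S\}$ (also when $S$ is an affine subspace), and $w^\perp:=\{w\}^\perp$. A nonempty convex subcone $F\subseteq K$ is a face of $K$, written $F\unlhd K$, if $x,y\in K$ and $x+y\in F$ imply $x,y\in F$. A vector $w$ is minimal for $L\cap F$ if $w\in L^\perp\cap(F^*\setminus F^\perp)$ and there is no $u\in L^\perp\cap(F^*\setminus F^\perp)$ with $F\cap w^\perp\subsetneq F\cap u^\perp$. *)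

theory Defs
  imports "HOL-Analysis.Analysis"
begin

text \<open>The orthogonal complement and the dual cone are taken inside an ambient subspace V:
  all of \<open>real^'n\<close> for the orthant, the symmetric matrices for the semidefinite cone.\<close>

definition perp_in :: "'a::real_inner set \<Rightarrow> 'a set \<Rightarrow> 'a set" where
  "perp_in V S = {y \<in> V. \<forall>x\<in>S. y \<bullet> x = 0}"

definition dual_cone_in :: "'a::real_inner set \<Rightarrow> 'a set \<Rightarrow> 'a set" where
  "dual_cone_in V F = {y \<in> V. \<forall>x\<in>F. 0 \<le> y \<bullet> x}"

text \<open>For a convex cone K these are exactly the nonempty faces in the sense of \<^const>\<open>face_of\<close>.\<close>

definition cone_face :: "'a::real_vector set \<Rightarrow> 'a set \<Rightarrow> bool" where
  "cone_face F K \<longleftrightarrow> convex_cone F \<and> F \<subseteq> K \<and>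
    (\<forall>x\<in>K. \<forall>y\<in>K. x + y \<in> F \<longrightarrow> x \<in> F \<and> y \<in> F)"

definition exposing_vectors :: "'a::real_inner set \<Rightarrow> 'a set \<Rightarrow> 'a set \<Rightarrow> 'a set" where
  "exposing_vectors V L F = perp_in V L \<inter> (dual_cone_in V F - perp_in V F)"

text \<open>Minimality depends on the pair L, F, not only on their intersection.\<close>

definition minimal_exposing :: "'a::real_inner set \<Rightarrow> 'a set \<Rightarrow> 'a set \<Rightarrow> 'a \<Rightarrow> bool" where
  "minimal_exposing V L F w \<longleftrightarrow> w \<in> exposing_vectors V L F \<and>
    \<not> (\<exists>u \<in> exposing_vectors V L F. F \<inter> perp_in V {w} \<subset> F \<inter> perp_in V {u})"

definition nonneg_orthant :: "(real^'n) set" where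
  "nonneg_orthant = {x. \<forall>i. 0 \<le> x $ i}"

definition sym_matrices :: "(real^'n^'n) set" where
  "sym_matrices = {X. transpose X = X}"

definition psd_cone :: "(real^'n^'n) set" where
  "psd_cone = {X \<in> sym_matrices. \<forall>v. 0 \<le> v \<bullet> (X *v v)}"

text \<open>On symmetric matrices the inner product of \<open>real^'n^'n\<close> is the trace inner product.\<close>

lemma inner_sym_matrices_eq_trace:
  fixes X Y :: "real^'n^'n"
  assumes "X \<in> sym_matrices" "Y \<in> sym_matrices"
  shows "X \<bullet> Y = trace (X ** Y)"
proof -
  have "Y $ i $ j = Y $ j $ i" for i j
    using assms(2) unfolding sym_matrices_def transpose_def by (simp add: vec_eq_iff)
  then show ?thesis
    by (simp add: trace_def matrix_matrix_mult_def inner_vec_def)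
qed

end

theory Submission
  imports Defs
begin

text \<open>
  Cutting a face \<open>F\<close> of a cone \<open>K\<close> with the hyperplane orthogonal to a vector of the dual cone of
  \<open>F\<close> gives a face of \<open>K\<close> again. If an exposing vector \<open>w\<close> were not minimal, some exposing vector
  \<open>u\<close> would therefore produce a chain of faces of \<open>K\<close>,
  \<open>F \<inter> w\<^sup>\<bottom> \<subset> F \<inter> u\<^sup>\<bottom> \<subset> F\<close>,
  whose second inclusion is strict because \<open>u\<close> does not vanish on \<open>F\<close>. So any integer-valued
  quantity that grows strictly along strict inclusions of faces drops by at least two from
  \<open>F\<close> to \<open>F \<inter> w\<^sup>\<bottom>\<close>; a drop of one forces minimality. This is
  \<open>minimal_exposing_if_drop_one\<close>, and what remains is the strict monotonicity of the two quantities.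

  For any cone in a Euclidean space the dimension qualifies, since a proper face of a convex set
  has smaller dimension (\<open>cone_face_dim_less\<close>). For the semidefinite cone so does the maximal rank
  (\<open>psd_face_max_rank_less\<close>): an \<open>X\<close> of maximal rank in a face \<open>B\<close> has the smallest kernel in
  \<open>B\<close>, so for every \<open>Y\<close> in \<open>B\<close> a small multiple of \<open>Y\<close> can be subtracted from \<open>X\<close> without leaving
  the cone. Hence every face that contains \<open>X\<close> contains all of \<open>B\<close>, and a strictly smaller face
  has no matrix of the same rank.
\<close>

section \<open>Chains of faces and exposing vectors\<close>

lemma cone_face_imp_face_of:
  assumes "cone_face A K" "cone_face B K" "A \<subseteq> B"
  shows "A face_of B"
  unfolding face_of_def
proof (intro conjI ballI impI)
  show "A \<subseteq> B" by fact
  show "convex A" using assms(1) by (simp add: cone_face_def convex_cone_def)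
next
  fix a b x assume ab: "a \<in> B" "b \<in> B" and x: "x \<in> A" "x \<in> open_segment a b"
  obtain t where t: "0 < t" "t < 1" "x = (1 - t) *\<^sub>R a + t *\<^sub>R b"
    using x(2) by (auto simp: in_segment)
  have cB: "convex_cone B" and cA: "convex_cone A" and BK: "B \<subseteq> K"
    using assms by (auto simp: cone_face_def)
  have "(1 - t) *\<^sub>R a \<in> K" "t *\<^sub>R b \<in> K"
    using convex_cone_scaleR[OF cB] ab t BK by (auto simp: subset_iff)
  then have in_A: "(1 - t) *\<^sub>R a \<in> A" "t *\<^sub>R b \<in> A"
    using assms(1) x(1) t(3) by (auto simp: cone_face_def)
  show "a \<in> A"
    using convex_cone_scaleR[OF cA _ in_A(1), of "1 / (1 - t)"] t by simp
  show "b \<in> A"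
    using convex_cone_scaleR[OF cA _ in_A(2), of "1 / t"] t by simp
qed

lemma cone_face_dim_less:
  fixes A B :: "'a::euclidean_space set"
  assumes "cone_face A K" "cone_face B K" "A \<subset> B"
  shows "dim A < dim B"
proof -
  have cc: "convex_cone A" "convex_cone B"
    using assms by (auto simp: cone_face_def)
  have "aff_dim A < aff_dim B"
    using face_of_aff_dim_lt cone_face_imp_face_of[OF assms(1,2)] assms(3) cc(2)
    by (auto simp: convex_cone_def)
  moreover have "aff_dim A = int (dim A)" "aff_dim B = int (dim B)"
    using cc by (simp_all add: aff_dim_zero hull_inc convex_cone_contains_0)
  ultimately show ?thesis by simp
qed

text \<open>Both summands of a sum orthogonal to \<open>u\<close> have nonnegative inner product with \<open>u\<close>, so both
  inner products vanish.\<close>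

lemma cone_face_Int_perp:
  assumes F: "cone_face F K" and KV: "K \<subseteq> V" and u: "u \<in> dual_cone_in V F"
  shows "cone_face (F \<inter> perp_in V {u}) K"
proof -
  have FV: "F \<subseteq> V" and cF: "convex_cone F"
    using F KV by (auto simp: cone_face_def)
  have eq: "F \<inter> perp_in V {u} = F \<inter> {x. x \<bullet> u = 0}"
    using FV by (auto simp: perp_in_def)
  have "convex_cone (F \<inter> {x. x \<bullet> u = 0})"
    using cF by (simp add: convex_cone_iff inner_add_left)
  moreover have "x \<in> F \<inter> {x. x \<bullet> u = 0} \<and> y \<in> F \<inter> {x. x \<bullet> u = 0}"
    if xy: "x \<in> K" "y \<in> K" "x + y \<in> F \<inter> {x. x \<bullet> u = 0}" for x y
  proof -
    have "x \<in> F" "y \<in> F" using F xy by (auto simp: cone_face_def)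
    moreover from this have "0 \<le> x \<bullet> u" "0 \<le> y \<bullet> u"
      using u by (auto simp: dual_cone_in_def inner_commute)
    moreover have "x \<bullet> u + y \<bullet> u = 0" using xy(3) by (simp add: inner_add_left)
    ultimately show ?thesis by simp
  qed
  ultimately show ?thesis
    using F unfolding eq by (auto simp: cone_face_def)
qed

lemma minimal_exposing_if_drop_one:
  fixes r :: "'a::real_inner set \<Rightarrow> nat"
  assumes strict: "\<And>A B. cone_face A K \<Longrightarrow> cone_face B K \<Longrightarrow> A \<subset> B \<Longrightarrow> r A < r B"
    and KV: "K \<subseteq> V" and F: "cone_face F K" and w: "w \<in> exposing_vectors V L F"
    and drop: "int (r F) - int (r (F \<inter> perp_in V {w})) = 1"
  shows "minimal_exposing V L F w"
  unfolding minimal_exposing_def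
proof (intro conjI notI)
  show "w \<in> exposing_vectors V L F" by fact
  assume "\<exists>u \<in> exposing_vectors V L F. F \<inter> perp_in V {w} \<subset> F \<inter> perp_in V {u}"
  then obtain u where u: "u \<in> exposing_vectors V L F"
    and wu: "F \<inter> perp_in V {w} \<subset> F \<inter> perp_in V {u}" by blast
  have face: "cone_face (F \<inter> perp_in V {z}) K" if "z \<in> exposing_vectors V L F" for z
    using that cone_face_Int_perp[OF F KV] by (simp add: exposing_vectors_def)
  have "F \<inter> perp_in V {u} \<subset> F"
    using u by (auto simp: exposing_vectors_def dual_cone_in_def perp_in_def inner_commute)
  then have "r (F \<inter> perp_in V {u}) < r F" using strict face[OF u] F by blast
  moreover have "r (F \<inter> perp_in V {w}) < r (F \<inter> perp_in V {u})"
    using strict face[OF w] face[OF u] wu by blast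
  ultimately show False using drop by simp
qed

section \<open>Kernels and ranks\<close>

lemma matrix_vector_eq_0_iff_orthogonal_rows:
  fixes A :: "real^'n^'m"
  shows "A *v x = 0 \<longleftrightarrow> (\<forall>y \<in> span (rows A). orthogonal x y)"
proof
  assume "\<forall>y \<in> span (rows A). orthogonal x y"
  then have "row i A \<bullet> x = 0" for i
    using span_base[of "row i A" "rows A"] unfolding rows_def orthogonal_def
    by (metis (mono_tags, lifting) UNIV_I inner_commute mem_Collect_eq)
  then show "A *v x = 0"
    by (simp add: vec_eq_iff matrix_vector_mul_component row_def)
qed (use orthogonal_nullspace_rowspace in blast)

lemma span_rows_mono_if_kernel_subset:
  fixes A B :: "real^'n^'m"
  assumes "\<And>x. A *v x = 0 \<Longrightarrow> B *v x = 0"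
  shows "span (rows B) \<subseteq> span (rows A)"
proof
  fix r assume r: "r \<in> span (rows B)"
  obtain y z where yz: "y \<in> span (rows A)" "\<And>v. v \<in> span (rows A) \<Longrightarrow> orthogonal z v" "r = y + z"
    by (metis orthogonal_subspace_decomp_exists)
  have "A *v z = 0" using yz(2) matrix_vector_eq_0_iff_orthogonal_rows by blast
  then have "orthogonal z r"
    using assms r matrix_vector_eq_0_iff_orthogonal_rows by blast
  then have "z \<bullet> z = 0" using yz(2)[OF yz(1)] yz(3) by (simp add: orthogonal_def inner_add_right)
  then show "r \<in> span (rows A)" using yz by simp
qed

lemma kernel_eq_if_subset_and_rank_le:
  fixes A B :: "real^'n^'m"
  assumes "\<And>x. A *v x = 0 \<Longrightarrow> B *v x = 0" and "rank A \<le> rank B"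
  shows "A *v x = 0 \<longleftrightarrow> B *v x = 0"
proof -
  have "span (rows B) = span (rows A)"
    using subspace_dim_equal[OF _ _ span_rows_mono_if_kernel_subset[OF assms(1)]] assms(2)
    by (simp add: row_rank_def)
  then show ?thesis by (simp add: matrix_vector_eq_0_iff_orthogonal_rows)
qed

section \<open>Positive semidefinite matrices\<close>

lemma inner_sym_matrix_vector:
  fixes X :: "real^'n^'n"
  assumes "X \<in> sym_matrices"
  shows "x \<bullet> (X *v y) = (X *v x) \<bullet> y"
  using assms by (metis (mono_tags) dot_lmul_matrix mem_Collect_eq sym_matrices_def transpose_matrix_vector)

text \<open>A vector \<open>v\<close> with \<open>v \<bullet> X v = 0\<close> minimises the quadratic form of \<open>X\<close>, so the derivative of the
  form at \<open>v\<close> vanishes. The derivative in the direction \<open>X v\<close> is twice the squared norm of \<open>X v\<close>.\<close>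

lemma psd_form_eq_0_iff:
  fixes X :: "real^'n^'n"
  assumes X: "X \<in> psd_cone"
  shows "v \<bullet> (X *v v) = 0 \<longleftrightarrow> X *v v = 0"
proof
  assume v0: "v \<bullet> (X *v v) = 0"
  define z where "z = X *v v"
  define c where "c = z \<bullet> (X *v z)"
  have sym: "X \<in> sym_matrices" using X by (simp add: psd_cone_def)
  have c: "c \<ge> 0" using X by (simp add: psd_cone_def c_def)
  have vz: "v \<bullet> (X *v z) = z \<bullet> z"
    using inner_sym_matrix_vector[OF sym] by (simp add: z_def)
  have nonneg: "0 \<le> t\<^sup>2 * c - 2 * t * (z \<bullet> z)" for t
  proof -
    have "0 \<le> (v - t *\<^sub>R z) \<bullet> (X *v (v - t *\<^sub>R z))" using X by (simp add: psd_cone_def)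
    also have "\<dots> = t\<^sup>2 * c - 2 * t * (z \<bullet> z)"
      using v0 vz
      by (simp add: matrix_vector_mult_diff_distrib matrix_vector_mult_scaleR inner_diff_left
          inner_diff_right c_def power2_eq_square z_def[symmetric] right_diff_distrib)
    finally show ?thesis .
  qed
  \<comment> \<open>For this \<open>t\<close> the linear term outweighs the quadratic one; the summand 1 covers \<open>c = 0\<close>.\<close>
  define t where "t = (z \<bullet> z) / (c + 1)"
  have t: "t \<ge> 0" "t * c \<le> z \<bullet> z" using c by (simp_all add: t_def field_simps)
  have "2 * t * (z \<bullet> z) \<le> t * (t * c)"
    using nonneg[of t] by (simp add: power2_eq_square)
  also have "\<dots> \<le> t * (z \<bullet> z)" using t by (intro mult_left_mono)
  finally have "t * (z \<bullet> z) \<le> 0" by simp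
  then have "z \<bullet> z \<le> 0"
    using c by (simp add: t_def divide_le_0_iff mult_le_0_iff)
  then have "z \<bullet> z = 0" using inner_ge_zero[of z] by linarith
  then show "X *v v = 0" by (simp add: z_def)
qed simp

text \<open>On the row space of \<open>X\<close>, the orthogonal complement of its kernel, the form of \<open>X\<close> is positive
  definite and so bounded below by a positive multiple of the squared norm; the form of \<open>Y\<close> is
  bounded above there. The kernel of \<open>X\<close> contributes to neither form.\<close>

lemma psd_diff_small_multiple:
  fixes X Y :: "real^'n^'n"
  assumes X: "X \<in> psd_cone" and Y: "Y \<in> psd_cone"
    and ker: "\<And>v. X *v v = 0 \<Longrightarrow> Y *v v = 0"
  shows "\<exists>e>0. X - e *\<^sub>R Y \<in> psd_cone"
proof -
  have symX: "X \<in> sym_matrices" and symY: "Y \<in> sym_matrices"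
    using X Y by (simp_all add: psd_cone_def)
  define R where "R = span (rows X)"
  have subR: "subspace R" by (simp add: R_def)
  obtain m where m: "m > 0" "\<And>q. q \<in> R \<Longrightarrow> m * (norm q)\<^sup>2 \<le> q \<bullet> (X *v q)"
  proof (cases "sphere 0 1 \<inter> R = {}")
    case True
    have "R \<subseteq> {0}"
    proof
      fix q assume "q \<in> R"
      then have "q \<noteq> 0 \<Longrightarrow> (1 / norm q) *\<^sub>R q \<in> sphere 0 1 \<inter> R"
        using subR by (simp add: subspace_scale)
      then show "q \<in> {0}" using True by blast
    qed
    then have "1 * (norm q)\<^sup>2 \<le> q \<bullet> (X *v q)" if "q \<in> R" for q
      using that by auto
    then show ?thesis using that[of 1] by simp
  next
    case False
    have "compact (sphere 0 1 \<inter> R)"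
      by (intro compact_Int_closed compact_sphere closed_subspace subR)
    moreover have "continuous_on (sphere 0 1 \<inter> R) (\<lambda>q. q \<bullet> (X *v q))"
      by (intro continuous_intros)
    ultimately obtain q0 where q0: "q0 \<in> sphere 0 1 \<inter> R"
      and min: "\<And>q. q \<in> sphere 0 1 \<inter> R \<Longrightarrow> q0 \<bullet> (X *v q0) \<le> q \<bullet> (X *v q)"
      using continuous_attains_inf[OF _ False] by blast
    define m where "m = q0 \<bullet> (X *v q0)"
    have "X *v q0 \<noteq> 0"
      using q0 nullspace_inter_rowspace[of X q0] by (auto simp: R_def)
    then have "m > 0"
      using X psd_form_eq_0_iff[OF X, of q0] by (auto simp: psd_cone_def m_def order_less_le)
    moreover have "m * (norm q)\<^sup>2 \<le> q \<bullet> (X *v q)" if q: "q \<in> R" for q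
    proof (cases "q = 0")
      case False
      define p where "p = (1 / norm q) *\<^sub>R q"
      have "p \<in> sphere 0 1 \<inter> R" using False q subR by (simp add: p_def subspace_scale)
      then have "m \<le> p \<bullet> (X *v p)" using min by (simp add: m_def)
      also have "\<dots> = (q \<bullet> (X *v q)) / (norm q)\<^sup>2"
        by (simp add: p_def matrix_vector_mult_scaleR power2_eq_square)
      finally show ?thesis using False by (simp add: field_simps)
    qed simp
    ultimately show ?thesis using that by blast
  qed
  obtain M where M: "M > 0" "\<And>q. norm (Y *v q) \<le> norm q * M"
    using bounded_linear.pos_bounded[OF matrix_vector_mul_bounded_linear[of Y]] by blast
  have Ybound: "q \<bullet> (Y *v q) \<le> M * (norm q)\<^sup>2" for q
  proof -
    have "q \<bullet> (Y *v q) \<le> norm q * norm (Y *v q)" by (rule norm_cauchy_schwarz)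
    also have "\<dots> \<le> norm q * (norm q * M)" using M(2) by (intro mult_left_mono) auto
    finally show ?thesis by (simp add: power2_eq_square mult_ac)
  qed
  define e where "e = m / M"
  have e: "e > 0" using m M by (simp add: e_def)
  have "0 \<le> v \<bullet> ((X - e *\<^sub>R Y) *v v)" for v
  proof -
    obtain q p where qp: "q \<in> R" "\<And>y. y \<in> R \<Longrightarrow> orthogonal p y" "v = q + p"
      by (metis R_def orthogonal_subspace_decomp_exists)
    have Xp: "X *v p = 0" using qp(2) matrix_vector_eq_0_iff_orthogonal_rows by (auto simp: R_def)
    have form: "v \<bullet> (A *v v) = q \<bullet> (A *v q)" if "A \<in> sym_matrices" "A *v p = 0" for A
      using that inner_sym_matrix_vector[OF that(1), of p q]
      by (simp add: qp(3) matrix_vector_right_distrib inner_add_left)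
    have "e * (q \<bullet> (Y *v q)) \<le> e * (M * (norm q)\<^sup>2)"
      using Ybound e by (intro mult_left_mono) auto
    also have "\<dots> = m * (norm q)\<^sup>2" using M by (simp add: e_def)
    also have "\<dots> \<le> q \<bullet> (X *v q)" using m qp by blast
    finally have "e * (v \<bullet> (Y *v v)) \<le> v \<bullet> (X *v v)"
      using form[OF symX Xp] form[OF symY ker[OF Xp]] by simp
    then show ?thesis
      by (simp add: matrix_vector_mult_diff_rdistrib scaleR_matrix_vector_assoc[symmetric]
          inner_diff_right)
  qed
  moreover have "X - e *\<^sub>R Y \<in> sym_matrices"
    using symX symY by (simp add: sym_matrices_def transpose_def vec_eq_iff)
  ultimately show ?thesis using e by (auto simp: psd_cone_def)
qed

text \<open>The form of \<open>X + Y\<close> vanishes only where both forms do, so its kernel lies in that of \<open>X\<close>;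
  the rank bound turns this inclusion into an equality.\<close>

lemma max_rank_kernel_subset:
  fixes X Y :: "real^'n^'n"
  assumes X: "X \<in> psd_cone" and Y: "Y \<in> psd_cone" and rk: "rank (X + Y) \<le> rank X"
    and v: "X *v v = 0"
  shows "Y *v v = 0"
proof -
  have sum_ker: "X *v z = 0 \<and> Y *v z = 0" if "(X + Y) *v z = 0" for z
  proof -
    have "z \<bullet> (X *v z) + z \<bullet> (Y *v z) = 0"
      using that by (simp add: inner_add_right[symmetric] matrix_vector_mult_add_rdistrib[symmetric])
    moreover have "0 \<le> z \<bullet> (X *v z)" "0 \<le> z \<bullet> (Y *v z)"
      using X Y by (simp_all add: psd_cone_def)
    ultimately have "z \<bullet> (X *v z) = 0" "z \<bullet> (Y *v z) = 0" by simp_all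
    then show ?thesis using psd_form_eq_0_iff X Y by blast
  qed
  then have "(X + Y) *v v = 0"
    using kernel_eq_if_subset_and_rank_le[OF _ rk, of v] v by blast
  then show ?thesis using sum_ker by blast
qed

lemma psd_face_max_rank_less:
  fixes A B :: "(real^'n^'n) set"
  assumes A: "cone_face A psd_cone" and B: "cone_face B psd_cone" and AB: "A \<subset> B"
  shows "Max (rank ` A) < Max (rank ` B)"
proof (rule ccontr)
  assume le: "\<not> Max (rank ` A) < Max (rank ` B)"
  have fin: "finite (rank ` S)" for S :: "(real^'n^'n) set"
    by (rule finite_subset[of _ "{..CARD('n)}"]) (use rank_bound in fastforce)+
  have "A \<noteq> {}" using A by (auto simp: cone_face_def convex_cone_def)
  then have "Max (rank ` A) \<in> rank ` A" by (intro Max_in[OF fin]) simp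
  then obtain X where X: "X \<in> A" "Max (rank ` A) = rank X" by (rule imageE) blast
  have cA: "convex_cone A" and cB: "convex_cone B" and BK: "B \<subseteq> psd_cone"
    using A B by (auto simp: cone_face_def)
  \<comment> \<open>As \<open>X\<close> has maximal rank even in \<open>B\<close>, each \<open>Y\<close> in \<open>B\<close> is, up to scaling, a summand of \<open>X\<close>.\<close>
  have "B \<subseteq> A"
  proof
    fix Y assume Y: "Y \<in> B"
    have psd: "X \<in> psd_cone" "Y \<in> psd_cone" using X Y AB BK by auto
    have "X + Y \<in> B" using convex_cone_add[OF cB] X Y AB by auto
    then have "rank (X + Y) \<le> rank X"
      using Max_ge[OF fin, of "rank (X + Y)" B] X(2) le by auto
    then obtain e where e: "e > 0" "X - e *\<^sub>R Y \<in> psd_cone"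
      using psd_diff_small_multiple[OF psd] max_rank_kernel_subset[OF psd] by blast
    have "e *\<^sub>R Y \<in> psd_cone" using convex_cone_scaleR[OF cB _ Y, of e] e BK by auto
    moreover have "(X - e *\<^sub>R Y) + e *\<^sub>R Y \<in> A" using X by simp
    ultimately have "e *\<^sub>R Y \<in> A" using A e(2) unfolding cone_face_def by blast
    then show "Y \<in> A" using convex_cone_scaleR[OF cA, of "1 / e" "e *\<^sub>R Y"] e by simp
  qed
  then show False using AB by blast
qed

section \<open>Minimality from a unit drop\<close>

theorem lemma3p2:
  "(\<forall>(L :: (real^'n) set) F w.
      affine L \<longrightarrow> L \<inter> nonneg_orthant \<noteq> {} \<longrightarrow>
      cone_face F nonneg_orthant \<longrightarrow> w \<in> exposing_vectors UNIV L F \<longrightarrow>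
      int (dim F) - int (dim (F \<inter> perp_in UNIV {w})) = 1 \<longrightarrow>
      minimal_exposing UNIV L F w) \<and>
   (\<forall>(L :: (real^'n^'n) set) F w.
      affine L \<longrightarrow> L \<subseteq> sym_matrices \<longrightarrow> L \<inter> psd_cone \<noteq> {} \<longrightarrow>
      cone_face F psd_cone \<longrightarrow> w \<in> exposing_vectors sym_matrices L F \<longrightarrow>
      int (Max (rank ` F)) - int (Max (rank ` (F \<inter> perp_in sym_matrices {w}))) = 1 \<longrightarrow>
      minimal_exposing sym_matrices L F w)"
proof (intro conjI allI impI)
  fix L F :: "(real^'n) set" and w
  assume "cone_face F nonneg_orthant" "w \<in> exposing_vectors UNIV L F"
    "int (dim F) - int (dim (F \<inter> perp_in UNIV {w})) = 1"
  then show "minimal_exposing UNIV L F w"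
    by (intro minimal_exposing_if_drop_one[where r = dim and K = nonneg_orthant] cone_face_dim_less)
      auto
next
  fix L F :: "(real^'n^'n) set" and w
  assume "cone_face F psd_cone" "w \<in> exposing_vectors sym_matrices L F"
    "int (Max (rank ` F)) - int (Max (rank ` (F \<inter> perp_in sym_matrices {w}))) = 1"
  moreover have "(psd_cone :: (real^'n^'n) set) \<subseteq> sym_matrices" by (auto simp: psd_cone_def)
  ultimately show "minimal_exposing sym_matrices L F w"
    using minimal_exposing_if_drop_one[where r = "\<lambda>S. Max (rank ` S)"] psd_face_max_rank_less
    by blast
qed

end
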